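(* Let $\mu_n=H\sqcup F\sqcup C$ be a partition of the set $\mu_n$ of $n$th roots of unity such that $|F|=|C|$ and each of $H,F,C$ is closed under complex conjugation. For each $\zeta\in H$ with $\zeta^2\neq1$ pick a unit vector $(v_\zeta,u_\zeta)\in\mathbb{C}^2$ such that $v_{\bar\zeta}=\overline{u_\zeta}$ and $u_{\bar\zeta}=\overline{v_\zeta}$; for $\zeta\in H$ with $\zeta^2=1$ pick $u_\zeta=1/\sqrt2$ and $v_\zeta=\pm1/\sqrt2$. Then the $2n\times 2n$ matrix $$X=\sum_{\zeta\in H}\begin{bmatrix}u_\zeta\overline{u_\zeta} & u_\zeta\overline{v_\zeta}\\ v_\zeta\overline{u_\zeta} & v_\zeta\overline{v_\zeta}\end{bmatrix}\otimes E_\zeta+\sum_{\zeta\in F}I_2\otimes E_\zeta$$ is a self-adjoint idempotent of rank $n$ in $\mathcal{SD}_n$. Furthermore, every self-adjoint idempotent of rank $n$ in $\mathcal{SD}_n$ is of this form.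
   Context: Indices of $n\times n$ matrices run over $0,\dots,n-1$. For an $n$th root of unity $\zeta$, $E_\zeta=\tfrac1n(\zeta^{j-i})_{i,j}$. $\mathcal{SD}_n$ is the set of all complex $2n\times 2n$ block matrices $[A,B;B^\top,A^\top]$ with $A,B$ complex circulant $n\times n$ matrices (an $n\times n$ matrix is circulant if its $(i,j)$ entry depends only on $(j-i)\bmod n$). For matrices $A,B$, $A\otimes B$ is the Kronecker product, the block matrix $(A_{i,j}B)_{i,j}$.
   Formalization: The condition on the unit vectors for ζ²≠1 is corrected to v_{ζ̄}=u_ζ and u_{ζ̄}=v_ζ (no conjugates on the right); as printed, with conjugates, the claim fails, e.g. n=4, H=μ_4, (u,v)=(1,i)/√2 at i and (−i,1)/√2 at −i, u=v=1/√2 at ±1. *)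

theory Defs
  imports
    "HOL.Complex"
    "Jordan_Normal_Form.Schur_Decomposition"
    "Jordan_Normal_Form.DL_Rank"
begin

definition roots_of_unity :: "nat \<Rightarrow> complex set" where
  "roots_of_unity n = {z. z ^ n = 1}"

definition circulant :: "nat \<Rightarrow> complex mat \<Rightarrow> bool" where
  "circulant n A \<longleftrightarrow> A \<in> carrier_mat n n \<and>
     (\<exists>a. \<forall>i<n. \<forall>j<n. A $$ (i, j) = a ((int j - int i) mod int n))"

definition SD :: "nat \<Rightarrow> complex mat set" where
  "SD n = {four_block_mat A B (transpose_mat B) (transpose_mat A) | A B.
             circulant n A \<and> circulant n B}"

definition E_mat :: "nat \<Rightarrow> complex \<Rightarrow> complex mat" where
  "E_mat n \<zeta> = mat n n (\<lambda>(i, j). (1 / of_nat n) * \<zeta> powi (int j - int i))"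

definition kronecker :: "complex mat \<Rightarrow> complex mat \<Rightarrow> complex mat" (infixl "\<otimes>\<^sub>K" 70) where
  "A \<otimes>\<^sub>K B = mat (dim_row A * dim_row B) (dim_col A * dim_col B)
     (\<lambda>(i, j). A $$ (i div dim_row B, j div dim_col B) * B $$ (i mod dim_row B, j mod dim_col B))"

definition self_adjoint :: "complex mat \<Rightarrow> bool" where
  "self_adjoint X \<longleftrightarrow> mat_adjoint X = X"

definition idempotent_mat :: "complex mat \<Rightarrow> bool" where
  "idempotent_mat X \<longleftrightarrow> X * X = X"

definition conj_closed :: "complex set \<Rightarrow> bool" where
  "conj_closed S \<longleftrightarrow> (\<forall>z\<in>S. cnj z \<in> S)"

definition mu_partition :: "nat \<Rightarrow> complex set \<Rightarrow> complex set \<Rightarrow> complex set \<Rightarrow> bool" where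
  "mu_partition n H F C \<longleftrightarrow>
     H \<union> F \<union> C = roots_of_unity n \<and> H \<inter> F = {} \<and> H \<inter> C = {} \<and> F \<inter> C = {} \<and>
     card F = card C \<and> conj_closed H \<and> conj_closed F \<and> conj_closed C"

(* The source imposes v (cnj z) = cnj (u z) and u (cnj z) = cnj (v z) on the non-real z in H.
   With these conjugates the statement is false in both directions. A self-adjoint
   element of SD n has a real upper-right block B, and the coefficient b z = u z * cnj (v z)
   of E_mat n z in B must therefore satisfy b (cnj z) = cnj (b z); the source's condition gives
   b (cnj z) = b z instead. For example, take n = 4, H = {1, -1, i, -i}, F = C = {},
   u = v = 1/sqrt 2 at 1 and -1, (u, v) = (1, i)/sqrt 2 at i and (u, v) = (-i, 1)/sqrt 2 at -i:
   the resulting X has entries (1-i)/4 at (0,4) and (1+i)/4 at (4,0), which are equal for every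
   member of SD 4. Dropping the two conjugates gives the intended condition, used here. *)
definition unit_vector_choice ::
  "complex set \<Rightarrow> (complex \<Rightarrow> complex) \<Rightarrow> (complex \<Rightarrow> complex) \<Rightarrow> bool" where
  "unit_vector_choice H u v \<longleftrightarrow>
     (\<forall>\<zeta>\<in>H. \<zeta>\<^sup>2 \<noteq> 1 \<longrightarrow>
        (cmod (v \<zeta>))\<^sup>2 + (cmod (u \<zeta>))\<^sup>2 = 1 \<and> v (cnj \<zeta>) = u \<zeta> \<and> u (cnj \<zeta>) = v \<zeta>) \<and>
     (\<forall>\<zeta>\<in>H. \<zeta>\<^sup>2 = 1 \<longrightarrow>
        u \<zeta> = of_real (1 / sqrt 2) \<and>
        (v \<zeta> = of_real (1 / sqrt 2) \<or> v \<zeta> = - of_real (1 / sqrt 2)))"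

definition outer_mat :: "complex \<Rightarrow> complex \<Rightarrow> complex mat" where
  "outer_mat u v = mat_of_rows_list 2 [[u * cnj u, u * cnj v], [v * cnj u, v * cnj v]]"

definition X_mat ::
  "nat \<Rightarrow> complex set \<Rightarrow> complex set \<Rightarrow> (complex \<Rightarrow> complex) \<Rightarrow> (complex \<Rightarrow> complex) \<Rightarrow> complex mat"
where
  "X_mat n H F u v =
     finsum (module_mat TYPE(complex) (2 * n) (2 * n))
       (\<lambda>\<zeta>. outer_mat (u \<zeta>) (v \<zeta>) \<otimes>\<^sub>K E_mat n \<zeta>) H +
     finsum (module_mat TYPE(complex) (2 * n) (2 * n)) (\<lambda>\<zeta>. 1\<^sub>m 2 \<otimes>\<^sub>K E_mat n \<zeta>) F"

end

theory Submission
  imports Defs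
begin

text \<open>
  The matrices \<open>E\<^sub>\<zeta>\<close> are orthogonal self-adjoint idempotents summing to the identity, so
  \<open>(M\<^sub>\<zeta>) \<mapsto> \<Sum>\<^sub>\<zeta> M\<^sub>\<zeta> \<otimes> E\<^sub>\<zeta>\<close> is an injective *-homomorphism from families of \<open>2 \<times> 2\<close> matrices. Since
  \<open>E\<^sub>\<zeta>\<close> transposes to the one of the conjugate root, its image meets \<open>SD n\<close> exactly in the
  families \<open>M\<^sub>\<zeta> = [a(\<zeta>), b(\<zeta>); b(cnj \<zeta>), a(cnj \<zeta>)]\<close>. A self-adjoint idempotent of \<open>SD n\<close> is
  therefore a family of orthogonal projections of this shape, and \<open>H\<close>, \<open>F\<close>, \<open>C\<close> collect the
  \<open>\<zeta>\<close> for which \<open>M\<^sub>\<zeta>\<close> has rank 1, 2, 0. The rank of an idempotent is its trace, here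
  \<open>|H| + 2|F|\<close>, which equals \<open>n = |H| + |F| + |C|\<close> exactly when \<open>|F| = |C|\<close>.
\<close>

subsection \<open>Rank of an idempotent matrix\<close>

text \<open>A vector of \<open>S\<close> outside the span could be adjoined to \<open>U\<close>
  without losing independence, against maximality.\<close>

lemma (in vec_space) in_span_maximal_indpt:
  assumes "finite S" "S \<subseteq> carrier_vec n" "maximal U (\<lambda>T. T \<subseteq> S \<and> lin_indpt T)" "s \<in> S"
  shows "s \<in> span U"
proof (rule ccontr)
  assume s: "s \<notin> span U"
  have U: "lin_indpt U" "U \<subseteq> S" using assms(3) by (auto simp: maximal_def)
  then have Uc: "U \<subseteq> carrier_vec n" using assms(2) by blast
  have "s \<notin> U" using s in_own_span Uc by auto
  moreover have "lin_indpt (U \<union> {s})"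
    using lin_dep_iff_in_span[of U s] Uc U(1) assms(2,4) s \<open>s \<notin> U\<close> by auto
  ultimately have "\<not> maximal U (\<lambda>T. T \<subseteq> S \<and> lin_indpt T)"
    unfolding maximal_def using U(2) assms(4) by (metis Un_insert_right insertI1 insert_subset sup_bot_right subset_insertI)
  then show False using assms(3) by blast
qed

text \<open>Choosing a basis among the columns factors \<open>A\<close> as a matrix \<open>W\<close>
  of basis columns times a matrix \<open>K\<close> of coefficients. Idempotency forces ones on the
  diagonal of \<open>K * W\<close>, which has the same trace as \<open>W * K\<close>.\<close>

lemma (in vec_space) idempotent_rank_eq_trace:
  assumes A: "A \<in> carrier_mat n n" and idem: "A * A = A"
  shows "of_nat (rank A) = (\<Sum>i<n. A $$ (i, i))"
proof -
  let ?C = "set (cols A)"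
  have C: "?C \<subseteq> carrier_vec n" using cols_dim A by blast
  have "lin_indpt {}" by (auto simp: lin_dep_def)
  then obtain S where S: "maximal S (\<lambda>T. T \<subseteq> ?C \<and> lin_indpt T)"
    using maximal_exists_superset[of ?C "\<lambda>T. T \<subseteq> ?C \<and> lin_indpt T" "{}"]
    by auto
  have S': "S \<subseteq> ?C" "lin_indpt S" using S by (auto simp: maximal_def)
  have finS: "finite S" using S'(1) finite_subset by blast
  have Sc: "S \<subseteq> carrier_vec n" using S' C by blast
  define c where "c j = (SOME a. col A j = lincomb a S)" for j
  have c: "col A j = lincomb (c j) S" if j: "j < n" for j
  proof -
    have "col A j \<in> ?C" using j A by (auto simp: cols_def)
    then have "col A j \<in> span S" using in_span_maximal_indpt[OF _ C S] by simp
    then obtain a where "lincomb a S = col A j"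
      using finite_in_span[OF finS, of "col A j"] Sc by auto
    from this[symmetric] show ?thesis unfolding c_def by (rule someI[where P = "\<lambda>a. col A j = lincomb a S"])
  qed
  have Aij: "A $$ (i, j) = (\<Sum>w\<in>S. c j w * w $ i)" if "i < n" "j < n" for i j
  proof -
    have "A $$ (i, j) = col A j $ i" using that A by simp
    also have "\<dots> = (\<Sum>w\<in>S. c j w * w $ i)"
      unfolding c[OF that(2)] by (rule lincomb_index[OF that(1) Sc])
    finally show ?thesis .
  qed
  \<comment> \<open>Each basis vector is itself a column of \<open>A\<close>, so idempotency says
    that \<open>A\<close> fixes it.\<close>
  have fixed: "(\<Sum>j<n. A $$ (i, j) * w $ j) = w $ i" if "w \<in> S" "i < n" for w i
  proof -
    obtain k where k: "k < n" "w = col A k"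
      using \<open>w \<in> S\<close> S' A by (auto simp: cols_def)
    have "(A * A) $$ (i, k) = (\<Sum>j<n. A $$ (i, j) * w $ j)"
      using that k A by (simp add: scalar_prod_def atLeast0LessThan)
    then show ?thesis using idem k that A by simp
  qed
  \<comment> \<open>\<open>d w w'\<close> is the coefficient of \<open>w'\<close> when
    \<open>A\<close> applied to \<open>w\<close>, which is \<open>w\<close> again, is expanded
    through the columns of \<open>A\<close>.\<close>
  define d where "d w w' = (\<Sum>j<n. c j w' * w $ j)" for w w'
  have diag: "d w w = 1" if w: "w \<in> S" for w
  proof (rule ccontr)
    assume ne: "d w w \<noteq> 1"
    \<comment> \<open>The expansion of \<open>w\<close> just described minus its trivial expansion
      is a linear relation on \<open>S\<close>; it is nontrivial at \<open>w\<close> when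
      \<open>d w w\<close> differs from 1.\<close>
    define e where "e w' = d w w' - (if w' = w then 1 else 0)" for w'
    have "lincomb e S = 0\<^sub>v n"
    proof (rule eq_vecI)
      fix i assume "i < dim_vec (0\<^sub>v n :: 'a vec)"
      then have i: "i < n" by simp
      have "w $ i = (\<Sum>j<n. (\<Sum>w'\<in>S. c j w' * w' $ i) * w $ j)"
        using fixed[OF w i] Aij[OF i] by simp
      also have "\<dots> = (\<Sum>j<n. \<Sum>w'\<in>S. c j w' * w $ j * w' $ i)"
        by (simp add: sum_distrib_left sum_distrib_right mult_ac)
      also have "\<dots> = (\<Sum>w'\<in>S. \<Sum>j<n. c j w' * w $ j * w' $ i)" by (rule sum.swap)
      also have "\<dots> = (\<Sum>w'\<in>S. d w w' * w' $ i)"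
        by (simp add: d_def sum_distrib_right)
      finally have 1: "(\<Sum>w'\<in>S. d w w' * w' $ i) = w $ i" by simp
      have 2: "(\<Sum>w'\<in>S. (if w' = w then 1 else 0) * w' $ i) = w $ i"
        using w finS by (simp add: if_distrib[of "\<lambda>x. x * _"] cong: if_cong)
      have "lincomb e S $ i = (\<Sum>w'\<in>S. e w' * w' $ i)" using lincomb_index[OF i Sc] .
      also have "\<dots> = 0" unfolding e_def left_diff_distrib sum_subtractf 1 2 by simp
      finally show "lincomb e S $ i = 0\<^sub>v n $ i" using i by simp
    qed (use lincomb_dim[OF finS Sc] in simp)
    then have "lin_dep S"
      unfolding lin_dep_def using finS w ne by (intro exI[of _ S] exI[of _ e] exI[of _ w]) (auto simp: e_def)
    then show False using S'(2) by blast
  qed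
  have "(\<Sum>i<n. A $$ (i, i)) = (\<Sum>i<n. \<Sum>w\<in>S. c i w * w $ i)" by (simp add: Aij)
  also have "\<dots> = (\<Sum>w\<in>S. d w w)" unfolding d_def by (rule sum.swap)
  also have "\<dots> = of_nat (card S)" by (simp add: diag)
  also have "card S = rank A" using rank_card_indpt[OF A S] by simp
  finally show ?thesis by simp
qed

subsection \<open>Sums over roots of unity\<close>

lemma finite_roots_of_unity: "n > 0 \<Longrightarrow> finite (roots_of_unity n)"
  unfolding roots_of_unity_def by (rule finite_roots_unity) simp

lemma card_roots_of_unity: "n > 0 \<Longrightarrow> card (roots_of_unity n) = n"
  unfolding roots_of_unity_def by (rule card_roots_unity_eq)

lemma roots_of_unity_nonzero: "n > 0 \<Longrightarrow> \<zeta> \<in> roots_of_unity n \<Longrightarrow> \<zeta> \<noteq> 0"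
  by (auto simp: roots_of_unity_def power_0_left)

lemma norm_root_of_unity: "n > 0 \<Longrightarrow> \<zeta> \<in> roots_of_unity n \<Longrightarrow> cmod \<zeta> = 1"
  unfolding roots_of_unity_def
  by (auto dest: power_eq_1_iff)

lemma cnj_root_of_unity:
  assumes "n > 0" "\<zeta> \<in> roots_of_unity n"
  shows "cnj \<zeta> = inverse \<zeta>"
  using norm_root_of_unity[OF assms] complex_norm_square[of \<zeta>]
  by (intro inverse_unique[symmetric]) simp

lemma cnj_root_of_unity_powi:
  assumes "n > 0" "\<zeta> \<in> roots_of_unity n"
  shows "cnj \<zeta> powi (i - j) = \<zeta> powi (j - i)"
  using cnj_root_of_unity[OF assms] power_int_minus[of \<zeta> "i - j"]
  by (simp add: power_int_inverse)

lemma cnj_in_roots_of_unity [simp]: "cnj \<zeta> \<in> roots_of_unity n \<longleftrightarrow> \<zeta> \<in> roots_of_unity n"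
proof -
  have "cnj \<zeta> ^ n = 1 \<longleftrightarrow> cnj (\<zeta> ^ n) = cnj 1" by simp
  then show ?thesis unfolding roots_of_unity_def complex_cnj_cancel_iff by simp
qed

lemma sum_roots_of_unity_cnj:
  "(\<Sum>\<zeta>\<in>roots_of_unity n. f (cnj \<zeta>)) = (\<Sum>\<zeta>\<in>roots_of_unity n. f \<zeta>)"
  by (rule sum.reindex_bij_witness[of _ cnj cnj]) auto

lemma sum_powers_root_of_unity:
  assumes "\<zeta> \<in> roots_of_unity n" "\<zeta> \<noteq> 1"
  shows "(\<Sum>k<n. \<zeta> ^ k) = 0"
  using assms by (simp add: geometric_sum roots_of_unity_def)

text \<open>This is the orthogonality of the \<open>E_mat n \<zeta>\<close>. The summand is a
  constant times the \<open>k\<close>-th power of \<open>\<zeta> / \<xi>\<close>, so the sum is a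
  geometric series over an nth root of unity, which vanishes unless the ratio is 1.\<close>

lemma sum_convolution_roots:
  assumes n: "n > 0" and \<zeta>: "\<zeta> \<in> roots_of_unity n" and \<xi>: "\<xi> \<in> roots_of_unity n"
  shows "(\<Sum>k<n. \<zeta> powi (int k - i) * \<xi> powi (j - int k)) =
           (if \<zeta> = \<xi> then of_nat n * \<zeta> powi (j - i) else 0)"
proof -
  have nz: "\<zeta> \<noteq> 0" "\<xi> \<noteq> 0" using n \<zeta> \<xi> roots_of_unity_nonzero by auto
  have "(\<Sum>k<n. \<zeta> powi (int k - i) * \<xi> powi (j - int k)) =
          (\<Sum>k<n. (\<xi> powi j / \<zeta> powi i) * (\<zeta> / \<xi>) ^ k)"
    using nz by (intro sum.cong) (auto simp: power_int_diff power_divide)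
  also have "\<dots> = (\<xi> powi j / \<zeta> powi i) * (\<Sum>k<n. (\<zeta> / \<xi>) ^ k)"
    by (simp add: sum_distrib_left)
  also have "\<dots> = (if \<zeta> = \<xi> then of_nat n * \<zeta> powi (j - i) else 0)"
  proof (cases "\<zeta> = \<xi>")
    case True
    then show ?thesis using nz by (simp add: power_int_diff)
  next
    case False
    have "\<zeta> / \<xi> \<in> roots_of_unity n" "\<zeta> / \<xi> \<noteq> 1"
      using \<zeta> \<xi> False nz by (auto simp: roots_of_unity_def power_divide)
    then show ?thesis using False sum_powers_root_of_unity by simp
  qed
  finally show ?thesis .
qed

lemma powi_root_of_unity_mod:
  assumes "n > 0" "\<zeta> \<in> roots_of_unity n"
  shows "\<zeta> powi (m mod int n) = \<zeta> powi m"
proof -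
  have "\<zeta> powi m = \<zeta> powi (int n * (m div int n) + m mod int n)" by simp
  also have "\<dots> = \<zeta> powi (int n * (m div int n)) * \<zeta> powi (m mod int n)"
    using roots_of_unity_nonzero[OF assms] by (subst power_int_add) auto
  also have "\<zeta> powi (int n * (m div int n)) = 1"
    using assms by (simp add: power_int_mult roots_of_unity_def)
  finally show ?thesis by simp
qed

text \<open>Multiplication by a primitive root \<omega> permutes the roots of unity and scales the
  sum by \<open>\<omega> powi m\<close>. For nonzero \<open>m\<close> in the given range this factor
  is not 1, so the sum vanishes.\<close>

lemma sum_roots_of_unity_powi:
  assumes n: "n > 0" and m: "\<bar>m\<bar> < int n"
  shows "(\<Sum>\<zeta>\<in>roots_of_unity n. \<zeta> powi m) = (if m = 0 then of_nat n else 0)"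
proof (cases "m = 0")
  case True
  then show ?thesis using card_roots_of_unity[OF n] by simp
next
  case False
  define k where "k = nat \<bar>m\<bar>"
  define \<omega> where "\<omega> = cis (2 * pi / real n)"
  have k: "0 < k" "k < n" using False m by (auto simp: k_def)
  have "cis (2 * pi * real k / real n) \<noteq> cis (2 * pi * real 0 / real n)"
    using inj_onD[OF bij_betw_imp_inj_on[OF bij_betw_roots_unity[OF n]], of k 0] k n by auto
  then have "\<omega> ^ k \<noteq> 1"
    unfolding \<omega>_def DeMoivre by (simp add: mult_ac)
  then have ne: "\<omega> powi m \<noteq> 1"
    by (cases "m \<ge> 0") (auto simp: k_def power_int_def power_inverse)
  have \<omega>n: "\<omega> ^ n = 1" using n by (simp add: \<omega>_def DeMoivre)
  have "\<omega> \<noteq> 0" by (simp add: \<omega>_def)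
  then have "(\<Sum>\<zeta>\<in>roots_of_unity n. (\<omega> * \<zeta>) powi m) = (\<Sum>\<zeta>\<in>roots_of_unity n. \<zeta> powi m)"
    by (intro sum.reindex_bij_witness[of _ "\<lambda>\<zeta>. \<zeta> / \<omega>" "\<lambda>\<zeta>. \<omega> * \<zeta>"])
       (use \<omega>n in \<open>auto simp: roots_of_unity_def power_mult_distrib power_divide\<close>)
  then have "\<omega> powi m * (\<Sum>\<zeta>\<in>roots_of_unity n. \<zeta> powi m) = (\<Sum>\<zeta>\<in>roots_of_unity n. \<zeta> powi m)"
    by (simp add: power_int_mult_distrib sum_distrib_left)
  then show ?thesis using ne False by simp
qed

subsection \<open>Block Fourier matrices\<close>

text \<open>This is the sum over all roots of the Kronecker products of the 2 x 2 matrix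
  \<open>M \<zeta>\<close> with \<open>E_mat n \<zeta>\<close>: \<open>div n\<close> gives the block
  of an index and \<open>mod n\<close> its position inside the block. The 2 x 2 matrices are encoded
  as functions, of which only the values at indices below 2 enter.\<close>

definition block_fourier :: "nat \<Rightarrow> (complex \<Rightarrow> nat \<Rightarrow> nat \<Rightarrow> complex) \<Rightarrow> complex mat" where
  "block_fourier n M = mat (2 * n) (2 * n) (\<lambda>(p, q).
     (\<Sum>\<zeta>\<in>roots_of_unity n.
        M \<zeta> (p div n) (q div n) * \<zeta> powi (int (q mod n) - int (p mod n))) / of_nat n)"

lemma block_fourier_carrier [simp]: "block_fourier n M \<in> carrier_mat (2 * n) (2 * n)"
  by (simp add: block_fourier_def)

lemma block_fourier_dim [simp]:
  "dim_row (block_fourier n M) = 2 * n" "dim_col (block_fourier n M) = 2 * n"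
  by (simp_all add: block_fourier_def)

lemma block_index_less: "i < n \<Longrightarrow> s < 2 \<Longrightarrow> s * n + i < 2 * (n::nat)"
  by (cases s) auto

lemma block_fourier_index:
  assumes "i < n" "j < n" "s < 2" "t < 2"
  shows "block_fourier n M $$ (s * n + i, t * n + j) =
           (\<Sum>\<zeta>\<in>roots_of_unity n. M \<zeta> s t * \<zeta> powi (int j - int i)) / of_nat n"
  using assms block_index_less by (simp add: block_fourier_def)

lemma block_index_cases:
  assumes "p < 2 * (n::nat)"
  obtains s i where "s < 2" "i < n" "p = s * n + i"
proof
  have "n > 0" using assms by (cases n) auto
  then show "p mod n < n" "p = (p div n) * n + p mod n" by auto
  show "p div n < 2" using assms by (simp add: less_mult_imp_div_less mult.commute)
qed

lemma mat_eq_blockI: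
  assumes "A \<in> carrier_mat (2 * n) (2 * n)" "B \<in> carrier_mat (2 * n) (2 * n)"
    and "\<And>s t i j. s < 2 \<Longrightarrow> t < 2 \<Longrightarrow> i < n \<Longrightarrow> j < n \<Longrightarrow>
           A $$ (s * n + i, t * n + j) = B $$ (s * n + i, t * n + j)"
  shows "A = B"
proof (rule eq_matI)
  fix p q assume "p < dim_row B" "q < dim_col B"
  then have "p < 2 * n" "q < 2 * n" using assms(2) by auto
  then show "A $$ (p, q) = B $$ (p, q)" by (metis block_index_cases assms(3))
qed (use assms in auto)

lemma sum_block: "(\<Sum>r<2 * (n::nat). f r) = (\<Sum>t<2. \<Sum>k<n. f (t * n + k))"
proof -
  have "(\<Sum>r<2 * n. f r) = (\<Sum>t<2. sum f {t * n..<t * n + n})"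
    by (rule sum.nat_group[symmetric])
  moreover have "sum f {t * n..<t * n + n} = (\<Sum>k<n. f (t * n + k))" for t
    using sum.shift_bounds_nat_ivl[of f 0 "t * n" n] by (simp add: atLeast0LessThan add.commute)
  ultimately show ?thesis by simp
qed

lemma block_fourier_cong:
  assumes "\<And>\<zeta> s t. \<zeta> \<in> roots_of_unity n \<Longrightarrow> s < 2 \<Longrightarrow> t < 2 \<Longrightarrow> M \<zeta> s t = M' \<zeta> s t"
  shows "block_fourier n M = block_fourier n M'"
  by (rule mat_eq_blockI[of _ n]) (simp_all add: block_fourier_index assms)

text \<open>The \<open>E_mat n \<zeta>\<close> are orthogonal idempotents, so the cross terms
  between distinct roots vanish and the product is formed root by root.\<close>

lemma block_fourier_mult:
  assumes n: "n > 0"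
  shows "block_fourier n M * block_fourier n M' =
           block_fourier n (\<lambda>\<zeta> s u. \<Sum>t<2. M \<zeta> s t * M' \<zeta> t u)"
proof (rule mat_eq_blockI[of _ n])
  fix s u i j :: nat assume s: "s < 2" and u: "u < 2" and i: "i < n" and j: "j < n"
  let ?R = "roots_of_unity n"
  have "(block_fourier n M * block_fourier n M') $$ (s * n + i, u * n + j) =
      (\<Sum>r<2 * n. block_fourier n M $$ (s * n + i, r) * block_fourier n M' $$ (r, u * n + j))"
    using s u i j block_index_less by (simp add: scalar_prod_def atLeast0LessThan)
  also have "\<dots> = (\<Sum>t<2. \<Sum>k<n. (\<Sum>\<zeta>\<in>?R. M \<zeta> s t * \<zeta> powi (int k - int i)) / of_nat n *
                                ((\<Sum>\<xi>\<in>?R. M' \<xi> t u * \<xi> powi (int j - int k)) / of_nat n))"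
    unfolding sum_block using s u i j by (intro sum.cong refl) (simp add: block_fourier_index)
  also have "\<dots> = (\<Sum>t<2. \<Sum>k<n. \<Sum>\<zeta>\<in>?R. \<Sum>\<xi>\<in>?R. M \<zeta> s t * M' \<xi> t u / (of_nat n)\<^sup>2 *
                      (\<zeta> powi (int k - int i) * \<xi> powi (int j - int k)))"
    by (simp add: sum_product sum_divide_distrib power2_eq_square mult_ac)
  also have "\<dots> = (\<Sum>t<2. \<Sum>\<zeta>\<in>?R. \<Sum>\<xi>\<in>?R. M \<zeta> s t * M' \<xi> t u / (of_nat n)\<^sup>2 *
                      (\<Sum>k<n. \<zeta> powi (int k - int i) * \<xi> powi (int j - int k)))"
    unfolding sum_distrib_left
    by (intro sum.cong refl, subst sum.swap, intro sum.cong refl sum.swap)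
  also have "\<dots> = (\<Sum>t<2. \<Sum>\<zeta>\<in>?R. \<Sum>\<xi>\<in>?R. if \<zeta> = \<xi> then
                      M \<zeta> s t * M' \<xi> t u / of_nat n * \<zeta> powi (int j - int i) else 0)"
    using n by (intro sum.cong refl) (simp add: sum_convolution_roots power2_eq_square)
  also have "\<dots> = (\<Sum>t<2. \<Sum>\<zeta>\<in>?R. M \<zeta> s t * M' \<zeta> t u / of_nat n * \<zeta> powi (int j - int i))"
    by (simp add: finite_roots_of_unity[OF n])
  also have "\<dots> = (\<Sum>\<zeta>\<in>?R. (\<Sum>t<2. M \<zeta> s t * M' \<zeta> t u) * \<zeta> powi (int j - int i)) / of_nat n"
    by (subst sum.swap) (simp add: sum_distrib_left sum_distrib_right sum_divide_distrib mult_ac)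
  finally show "(block_fourier n M * block_fourier n M') $$ (s * n + i, u * n + j) =
      block_fourier n (\<lambda>\<zeta> s u. \<Sum>t<2. M \<zeta> s t * M' \<zeta> t u) $$ (s * n + i, u * n + j)"
    using s u i j by (simp add: block_fourier_index)
qed (auto intro: mult_carrier_mat)

text \<open>A discrete Fourier transform of the first row of block \<open>(s, t)\<close> recovers
  the coefficients; hence the representation is injective.\<close>

lemma block_fourier_coefficient:
  assumes n: "n > 0" and "s < 2" "t < 2" and \<xi>: "\<xi> \<in> roots_of_unity n"
  shows "(\<Sum>j<n. block_fourier n M $$ (s * n, t * n + j) * \<xi> powi (- int j)) = M \<xi> s t"
proof -
  let ?R = "roots_of_unity n"
  have "(\<Sum>j<n. block_fourier n M $$ (s * n, t * n + j) * \<xi> powi (- int j)) =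
      (\<Sum>j<n. \<Sum>\<zeta>\<in>?R. M \<zeta> s t / of_nat n * (\<zeta> powi (int j - 0) * \<xi> powi (0 - int j)))"
    using block_fourier_index[of 0 n _ s t M] assms
    by (intro sum.cong refl) (simp add: sum_distrib_left sum_distrib_right sum_divide_distrib mult_ac)
  also have "\<dots> = (\<Sum>\<zeta>\<in>?R. M \<zeta> s t / of_nat n * (\<Sum>j<n. \<zeta> powi (int j - 0) * \<xi> powi (0 - int j)))"
    unfolding sum_distrib_left by (rule sum.swap)
  also have "\<dots> = (\<Sum>\<zeta>\<in>?R. if \<zeta> = \<xi> then M \<zeta> s t else 0)"
    using n \<xi> by (intro sum.cong refl) (subst sum_convolution_roots, auto)
  also have "\<dots> = M \<xi> s t" using \<xi> by (simp add: finite_roots_of_unity[OF n])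
  finally show ?thesis .
qed

lemma block_fourier_inject:
  assumes "n > 0" "block_fourier n M = block_fourier n M'"
    and "s < 2" "t < 2" "\<xi> \<in> roots_of_unity n"
  shows "M \<xi> s t = M' \<xi> s t"
  using block_fourier_coefficient[of n s t \<xi> M] block_fourier_coefficient[of n s t \<xi> M'] assms by simp

lemma mat_adjoint_index:
  "i < dim_col A \<Longrightarrow> j < dim_row A \<Longrightarrow> mat_adjoint A $$ (i, j) = cnj (A $$ (j, i))"
  by (simp add: mat_adjoint_def mat_of_rows_index)

lemma mat_adjoint_carrier: "A \<in> carrier_mat nr nc \<Longrightarrow> mat_adjoint A \<in> carrier_mat nc nr"
  by (auto simp: mat_adjoint_def)

text \<open>Conjugation inverts a root of unity, so every \<open>E_mat n \<zeta>\<close> is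
  self-adjoint and only the coefficient matrices change.\<close>

lemma block_fourier_adjoint:
  assumes n: "n > 0"
  shows "mat_adjoint (block_fourier n M) = block_fourier n (\<lambda>\<zeta> s t. cnj (M \<zeta> t s))"
proof (rule mat_eq_blockI[of _ n])
  fix s t i j :: nat assume *: "s < 2" "t < 2" "i < n" "j < n"
  show "mat_adjoint (block_fourier n M) $$ (s * n + i, t * n + j) =
      block_fourier n (\<lambda>\<zeta> s t. cnj (M \<zeta> t s)) $$ (s * n + i, t * n + j)"
    using * block_index_less
    by (simp add: mat_adjoint_index block_fourier_index cnj_root_of_unity_powi[OF n])
qed (auto intro: mat_adjoint_carrier)

text \<open>All diagonal entries of \<open>E_mat n \<zeta>\<close> are \<open>1 / n\<close>, so its
  trace is 1.\<close>

lemma block_fourier_trace: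
  assumes "n > 0"
  shows "(\<Sum>p<2 * n. block_fourier n M $$ (p, p)) = (\<Sum>\<zeta>\<in>roots_of_unity n. \<Sum>s<2. M \<zeta> s s)"
proof -
  have "(\<Sum>p<2 * n. block_fourier n M $$ (p, p)) =
      (\<Sum>s<2. \<Sum>i<n. (\<Sum>\<zeta>\<in>roots_of_unity n. M \<zeta> s s) / of_nat n)"
    unfolding sum_block by (intro sum.cong refl) (simp add: block_fourier_index)
  also have "\<dots> = (\<Sum>\<zeta>\<in>roots_of_unity n. \<Sum>s<2. M \<zeta> s s)"
    using assms by (subst sum.swap) simp
  finally show ?thesis .
qed

subsection \<open>Circulant matrices and Kronecker products\<close>

definition fourier_circulant :: "nat \<Rightarrow> (complex \<Rightarrow> complex) \<Rightarrow> complex mat" where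
  "fourier_circulant n f = mat n n (\<lambda>(i, j).
     (\<Sum>\<zeta>\<in>roots_of_unity n. f \<zeta> * \<zeta> powi (int j - int i)) / of_nat n)"

text \<open>One direction is Fourier inversion of the sequence \<open>a\<close>; the other holds
  because powers of an nth root of unity depend only on the exponent mod \<open>n\<close>.\<close>

lemma circulant_iff_fourier:
  assumes n: "n > 0"
  shows "circulant n A \<longleftrightarrow> (\<exists>f. A = fourier_circulant n f)"
proof
  assume "circulant n A"
  then obtain a where A: "A \<in> carrier_mat n n"
    and a: "\<And>i j. i < n \<Longrightarrow> j < n \<Longrightarrow> A $$ (i, j) = a ((int j - int i) mod int n)"
    by (auto simp: circulant_def)
  define f where "f \<zeta> = (\<Sum>k<n. a (int k) * \<zeta> powi (- int k))" for \<zeta>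
  have "A = fourier_circulant n f"
  proof (rule eq_matI)
    fix i j assume "i < dim_row (fourier_circulant n f)" "j < dim_col (fourier_circulant n f)"
    then have ij: "i < n" "j < n" by (auto simp: fourier_circulant_def)
    \<comment> \<open>Taking the representative of the residue below \<open>n\<close> keeps
      \<open>int m - int k\<close> strictly between \<open>-n\<close> and \<open>n\<close>, as
      \<open>sum_roots_of_unity_powi\<close> requires.\<close>
    define m where "m = nat ((int j - int i) mod int n)"
    have m: "m < n" "int m = (int j - int i) mod int n" using n by (auto simp: m_def nat_less_iff)
    have "(\<Sum>\<zeta>\<in>roots_of_unity n. f \<zeta> * \<zeta> powi (int j - int i)) =
        (\<Sum>\<zeta>\<in>roots_of_unity n. \<Sum>k<n. a (int k) * \<zeta> powi (int m - int k))"
    proof (rule sum.cong[OF refl])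
      fix \<zeta> assume \<zeta>: "\<zeta> \<in> roots_of_unity n"
      have "\<zeta> powi (- int k) * \<zeta> powi (int j - int i) = \<zeta> powi (int m - int k)" for k
        using powi_root_of_unity_mod[OF n \<zeta>, of "int j - int i"] roots_of_unity_nonzero[OF n \<zeta>]
        by (simp add: m power_int_add[symmetric] power_int_diff power_int_minus divide_inverse)
      then show "f \<zeta> * \<zeta> powi (int j - int i) = (\<Sum>k<n. a (int k) * \<zeta> powi (int m - int k))"
        by (simp add: f_def sum_distrib_right mult.assoc)
    qed
    also have "\<dots> = (\<Sum>k<n. a (int k) * (\<Sum>\<zeta>\<in>roots_of_unity n. \<zeta> powi (int m - int k)))"
      unfolding sum_distrib_left by (rule sum.swap)
    also have "\<dots> = (\<Sum>k<n. if k = m then a (int m) * of_nat n else 0)"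
      using m(1) by (intro sum.cong refl) (subst sum_roots_of_unity_powi[OF n], auto)
    also have "\<dots> = a (int m) * of_nat n" using m(1) by simp
    finally show "A $$ (i, j) = fourier_circulant n f $$ (i, j)"
      using ij n a by (simp add: fourier_circulant_def m)
  qed (use A in \<open>auto simp: fourier_circulant_def\<close>)
  then show "\<exists>f. A = fourier_circulant n f" by blast
next
  assume "\<exists>f. A = fourier_circulant n f"
  then obtain f where A: "A = fourier_circulant n f" by blast
  show "circulant n A" unfolding circulant_def A
    by (auto simp: fourier_circulant_def powi_root_of_unity_mod[OF n]
        intro!: exI[of _ "\<lambda>m. (\<Sum>\<zeta>\<in>roots_of_unity n. f \<zeta> * \<zeta> powi m) / of_nat n"])
qed

text \<open>Transposition inverts the powers of \<zeta>, which amounts to conjugating the root;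
  reindexing the sum moves the conjugation to the coefficient.\<close>

lemma transpose_fourier_circulant:
  assumes n: "n > 0"
  shows "transpose_mat (fourier_circulant n f) = fourier_circulant n (\<lambda>\<zeta>. f (cnj \<zeta>))"
proof (rule eq_matI)
  fix i j assume "i < dim_row (fourier_circulant n (\<lambda>\<zeta>. f (cnj \<zeta>)))"
    "j < dim_col (fourier_circulant n (\<lambda>\<zeta>. f (cnj \<zeta>)))"
  then have ij: "i < n" "j < n" by (auto simp: fourier_circulant_def)
  have "(\<Sum>\<zeta>\<in>roots_of_unity n. f \<zeta> * \<zeta> powi (int i - int j)) =
      (\<Sum>\<zeta>\<in>roots_of_unity n. f (cnj \<zeta>) * cnj \<zeta> powi (int i - int j))"
    by (rule sum_roots_of_unity_cnj[symmetric])
  also have "\<dots> = (\<Sum>\<zeta>\<in>roots_of_unity n. f (cnj \<zeta>) * \<zeta> powi (int j - int i))"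
    by (simp add: cnj_root_of_unity_powi[OF n])
  finally show "transpose_mat (fourier_circulant n f) $$ (i, j) =
      fourier_circulant n (\<lambda>\<zeta>. f (cnj \<zeta>)) $$ (i, j)"
    using ij by (simp add: fourier_circulant_def)
qed (auto simp: fourier_circulant_def)

lemma four_block_fourier_circulant:
  "four_block_mat (fourier_circulant n a) (fourier_circulant n b)
     (fourier_circulant n c) (fourier_circulant n d) =
   block_fourier n (\<lambda>\<zeta> s t. if s = 0 then if t = 0 then a \<zeta> else b \<zeta>
                                     else if t = 0 then c \<zeta> else d \<zeta>)"
proof (rule mat_eq_blockI[of _ n])
  fix s t i j :: nat assume *: "s < 2" "t < 2" "i < n" "j < n"
  then have "s = 0 \<or> s = 1" "t = 0 \<or> t = 1" by auto
  then show "four_block_mat (fourier_circulant n a) (fourier_circulant n b)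
     (fourier_circulant n c) (fourier_circulant n d) $$ (s * n + i, t * n + j) =
   block_fourier n (\<lambda>\<zeta> s t. if s = 0 then if t = 0 then a \<zeta> else b \<zeta>
                    else if t = 0 then c \<zeta> else d \<zeta>) $$ (s * n + i, t * n + j)"
    unfolding block_fourier_index[OF *(3,4,1,2)]
    using * by (auto simp: fourier_circulant_def)
qed (auto simp: fourier_circulant_def)

text \<open>The lower blocks are transposes of the upper ones, so the second row of each coefficient
  matrix is the first row reversed and evaluated at the conjugate root.\<close>

lemma SD_iff_fourier:
  assumes n: "n > 0"
  shows "X \<in> SD n \<longleftrightarrow>
    (\<exists>a b. X = block_fourier n (\<lambda>\<zeta> s t. (if s = t then a else b) (if s = 0 then \<zeta> else cnj \<zeta>)))"
proof -
  have "four_block_mat (fourier_circulant n a) (fourier_circulant n b)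
          (transpose_mat (fourier_circulant n b)) (transpose_mat (fourier_circulant n a)) =
        block_fourier n (\<lambda>\<zeta> s t. (if s = t then a else b) (if s = 0 then \<zeta> else cnj \<zeta>))" for a b
    unfolding transpose_fourier_circulant[OF n] four_block_fourier_circulant
    by (rule block_fourier_cong) (auto simp: less_2_cases_iff)
  then show ?thesis
    unfolding SD_def circulant_iff_fourier[OF n] by auto metis+
qed

section \<open>Sums of Kronecker products as block Fourier matrices\<close>

lemma finsum_module_mat:
  assumes "finite A" "\<And>x. x \<in> A \<Longrightarrow> f x \<in> carrier_mat nr nc"
  shows "finsum (module_mat TYPE('a :: comm_ring_1) nr nc) f A =
           mat nr nc (\<lambda>(i, j). \<Sum>x\<in>A. f x $$ (i, j))"
proof -
  interpret abelian_group "module_mat TYPE('a) nr nc" by (rule abelian_group_mat)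
  show ?thesis using assms
  proof (induction A rule: finite_induct)
    case empty
    show ?case by (auto simp: module_mat_simps)
  next
    case (insert x A)
    have "finsum (module_mat TYPE('a) nr nc) f (insert x A) =
        f x + mat nr nc (\<lambda>(i, j). \<Sum>x\<in>A. f x $$ (i, j))"
      using insert by (subst finsum_insert) (auto simp: module_mat_simps)
    also have "\<dots> = mat nr nc (\<lambda>(i, j). \<Sum>x\<in>insert x A. f x $$ (i, j))"
      using insert.hyps insert.prems by (intro eq_matI) auto
    finally show ?case .
  qed
qed

lemma kronecker_E_mat_index:
  assumes "A \<in> carrier_mat 2 2" "s < 2" "t < 2" "i < n" "j < n"
  shows "(A \<otimes>\<^sub>K E_mat n \<zeta>) $$ (s * n + i, t * n + j) =
           A $$ (s, t) * \<zeta> powi (int j - int i) / of_nat n"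
  using assms block_index_less by (simp add: kronecker_def E_mat_def)

lemma kronecker_E_mat_carrier:
  "A \<in> carrier_mat 2 2 \<Longrightarrow> A \<otimes>\<^sub>K E_mat n \<zeta> \<in> carrier_mat (2 * n) (2 * n)"
  by (auto simp: kronecker_def E_mat_def)

lemma finsum_kronecker_E_mat:
  assumes n: "n > 0" and S: "S \<subseteq> roots_of_unity n" and A: "\<And>\<zeta>. A \<zeta> \<in> carrier_mat 2 2"
  shows "finsum (module_mat TYPE(complex) (2 * n) (2 * n)) (\<lambda>\<zeta>. A \<zeta> \<otimes>\<^sub>K E_mat n \<zeta>) S =
           block_fourier n (\<lambda>\<zeta> s t. if \<zeta> \<in> S then A \<zeta> $$ (s, t) else 0)"
proof (rule mat_eq_blockI[of _ n])
  have fin: "finite S" using S finite_roots_of_unity[OF n] by (rule finite_subset)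
  have eq: "finsum (module_mat TYPE(complex) (2 * n) (2 * n)) (\<lambda>\<zeta>. A \<zeta> \<otimes>\<^sub>K E_mat n \<zeta>) S =
      mat (2 * n) (2 * n) (\<lambda>(p, q). \<Sum>\<zeta>\<in>S. (A \<zeta> \<otimes>\<^sub>K E_mat n \<zeta>) $$ (p, q))"
    using fin A by (intro finsum_module_mat) (auto intro: kronecker_E_mat_carrier)
  then show "finsum (module_mat TYPE(complex) (2 * n) (2 * n)) (\<lambda>\<zeta>. A \<zeta> \<otimes>\<^sub>K E_mat n \<zeta>) S
      \<in> carrier_mat (2 * n) (2 * n)" by simp
  fix s t i j :: nat assume *: "s < 2" "t < 2" "i < n" "j < n"
  have "(\<Sum>\<zeta>\<in>roots_of_unity n. (if \<zeta> \<in> S then A \<zeta> $$ (s, t) else 0) * \<zeta> powi (int j - int i)) =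
      (\<Sum>\<zeta>\<in>S. A \<zeta> $$ (s, t) * \<zeta> powi (int j - int i))"
    using S finite_roots_of_unity[OF n] by (intro sum.mono_neutral_cong_right) auto
  then show "finsum (module_mat TYPE(complex) (2 * n) (2 * n)) (\<lambda>\<zeta>. A \<zeta> \<otimes>\<^sub>K E_mat n \<zeta>) S
        $$ (s * n + i, t * n + j) =
      block_fourier n (\<lambda>\<zeta> s t. if \<zeta> \<in> S then A \<zeta> $$ (s, t) else 0) $$ (s * n + i, t * n + j)"
    unfolding eq using * A block_index_less
    by (simp add: block_fourier_index kronecker_E_mat_index sum_divide_distrib)
qed simp

lemma block_fourier_add:
  "block_fourier n M + block_fourier n M' = block_fourier n (\<lambda>\<zeta> s t. M \<zeta> s t + M' \<zeta> s t)"
  by (rule mat_eq_blockI[of _ n])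
     (simp_all add: block_fourier_index block_index_less distrib_right sum.distrib add_divide_distrib)

text \<open>The coefficient family of \<open>X_mat\<close>: for unit vectors it is the orthogonal
  projection onto the line through \<open>(u \<zeta>, v \<zeta>)\<close> on \<open>H\<close>, the
  identity on \<open>F\<close>, and zero elsewhere.\<close>

definition projection_coeff ::
  "complex set \<Rightarrow> complex set \<Rightarrow> (complex \<Rightarrow> complex) \<Rightarrow> (complex \<Rightarrow> complex) \<Rightarrow>
     complex \<Rightarrow> nat \<Rightarrow> nat \<Rightarrow> complex" where
  "projection_coeff H F u v \<zeta> s t =
     (if \<zeta> \<in> H then (if s = 0 then u \<zeta> else v \<zeta>) * cnj (if t = 0 then u \<zeta> else v \<zeta>)
      else if \<zeta> \<in> F \<and> s = t then 1 else 0)"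

lemma outer_mat_carrier [simp]: "outer_mat u v \<in> carrier_mat 2 2"
  by (auto simp: outer_mat_def mat_of_rows_list_def)

lemma outer_mat_index:
  "s < 2 \<Longrightarrow> t < 2 \<Longrightarrow>
     outer_mat u v $$ (s, t) = (if s = 0 then u else v) * cnj (if t = 0 then u else v)"
  by (auto simp: outer_mat_def mat_of_rows_list_def less_2_cases_iff)

lemma X_mat_fourier:
  assumes n: "n > 0" and HF: "H \<subseteq> roots_of_unity n" "F \<subseteq> roots_of_unity n" "H \<inter> F = {}"
  shows "X_mat n H F u v = block_fourier n (projection_coeff H F u v)"
proof -
  have "X_mat n H F u v = block_fourier n (\<lambda>\<zeta> s t.
      (if \<zeta> \<in> H then outer_mat (u \<zeta>) (v \<zeta>) $$ (s, t) else 0) +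
      (if \<zeta> \<in> F then 1\<^sub>m 2 $$ (s, t) else 0))"
    unfolding X_mat_def using n HF(1,2) by (simp add: finsum_kronecker_E_mat block_fourier_add)
  also have "\<dots> = block_fourier n (projection_coeff H F u v)"
    using HF(3) by (intro block_fourier_cong) (auto simp: projection_coeff_def outer_mat_index)
  finally show ?thesis .
qed

subsection \<open>Classification of the self-adjoint idempotents\<close>

lemma root_of_unity_square_eq_1_iff:
  assumes "n > 0" "\<zeta> \<in> roots_of_unity n"
  shows "\<zeta>\<^sup>2 = 1 \<longleftrightarrow> cnj \<zeta> = \<zeta>"
proof -
  have "\<zeta>\<^sup>2 = 1 \<longleftrightarrow> inverse \<zeta> = \<zeta>"
    using roots_of_unity_nonzero[OF assms] by (auto simp: power2_eq_square field_simps)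
  then show ?thesis using cnj_root_of_unity[OF assms] by simp
qed

text \<open>Rank equals trace for idempotents, and the trace is additive over the roots; this turns
  the rank condition into a count of roots.\<close>

lemma rank_block_fourier_idempotent:
  assumes n: "n > 0" and idem: "idempotent_mat (block_fourier n M)"
  shows "of_nat (vec_space.rank (2 * n) (block_fourier n M)) =
           (\<Sum>\<zeta>\<in>roots_of_unity n. M \<zeta> 0 0 + M \<zeta> 1 1)"
proof -
  have "(\<Sum>s<2. M \<zeta> s s) = M \<zeta> 0 0 + M \<zeta> 1 1" for \<zeta> by (simp add: numeral_2_eq_2)
  then show ?thesis
    using vec_space.idempotent_rank_eq_trace[of "block_fourier n M" "2 * n"] idem
    by (simp only: idempotent_mat_def block_fourier_trace[OF n] block_fourier_carrier)
qed

lemma mu_partitionD: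
  assumes "mu_partition n H F C"
  shows "H \<subseteq> roots_of_unity n" "F \<subseteq> roots_of_unity n" "H \<inter> F = {}"
    "cnj \<zeta> \<in> H \<longleftrightarrow> \<zeta> \<in> H" "cnj \<zeta> \<in> F \<longleftrightarrow> \<zeta> \<in> F"
proof -
  show "H \<subseteq> roots_of_unity n" "F \<subseteq> roots_of_unity n" "H \<inter> F = {}"
    using assms by (auto simp: mu_partition_def)
  have "\<forall>z\<in>H. cnj z \<in> H" "\<forall>z\<in>F. cnj z \<in> F"
    using assms by (auto simp: mu_partition_def conj_closed_def)
  then show "cnj \<zeta> \<in> H \<longleftrightarrow> \<zeta> \<in> H" "cnj \<zeta> \<in> F \<longleftrightarrow> \<zeta> \<in> F" by force+
qed

lemma mu_partition_card:
  assumes "n > 0" "H \<union> F \<union> C = roots_of_unity n" "H \<inter> F = {}" "H \<inter> C = {}" "F \<inter> C = {}"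
  shows "card H + card F + card C = n"
proof -
  have fin: "finite H" "finite F" "finite C"
    using finite_roots_of_unity[OF assms(1)] assms(2) by (metis finite_Un)+
  have "card (H \<union> F \<union> C) = card H + card F + card C"
    using fin assms(3-5) by (subst card_Un_disjoint, auto)+
  then show ?thesis using assms(1,2) card_roots_of_unity by simp
qed

section \<open>From a partition and unit vectors to a projection\<close>

lemma unit_vector_choice_norm:
  assumes "unit_vector_choice H u v" "\<zeta> \<in> H"
  shows "u \<zeta> * cnj (u \<zeta>) + v \<zeta> * cnj (v \<zeta>) = 1"
proof (cases "\<zeta>\<^sup>2 = 1")
  case True
  have "complex_of_real (1 / sqrt 2) * complex_of_real (1 / sqrt 2) = 1 / 2"
    unfolding of_real_mult[symmetric] by simp
  then show ?thesis using assms True by (auto simp: unit_vector_choice_def)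
next
  case False
  then have "(cmod (v \<zeta>))\<^sup>2 + (cmod (u \<zeta>))\<^sup>2 = 1" using assms by (auto simp: unit_vector_choice_def)
  then have "complex_of_real ((cmod (v \<zeta>))\<^sup>2 + (cmod (u \<zeta>))\<^sup>2) = 1" by (simp only: of_real_1)
  then show ?thesis unfolding of_real_add complex_norm_square by (simp add: add.commute)
qed

text \<open>These are the relations between the coefficients at conjugate roots that membership in
  \<open>SD n\<close> demands. At a non-real root they come from swapping \<open>u\<close> and
  \<open>v\<close>; at a real root both numbers are real and of equal modulus.\<close>

lemma unit_vector_choice_cnj:
  assumes "unit_vector_choice H u v" "\<zeta> \<in> H" "n > 0" "\<zeta> \<in> roots_of_unity n"
  shows "u (cnj \<zeta>) * cnj (u (cnj \<zeta>)) = v \<zeta> * cnj (v \<zeta>)"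
    "u (cnj \<zeta>) * cnj (v (cnj \<zeta>)) = v \<zeta> * cnj (u \<zeta>)"
proof -
  have "u (cnj \<zeta>) * cnj (u (cnj \<zeta>)) = v \<zeta> * cnj (v \<zeta>) \<and>
      u (cnj \<zeta>) * cnj (v (cnj \<zeta>)) = v \<zeta> * cnj (u \<zeta>)"
  proof (cases "\<zeta>\<^sup>2 = 1")
    case True
    then have "cnj \<zeta> = \<zeta>" using root_of_unity_square_eq_1_iff assms by blast
    then show ?thesis using assms True by (auto simp: unit_vector_choice_def)
  qed (use assms in \<open>auto simp: unit_vector_choice_def\<close>)
  then show "u (cnj \<zeta>) * cnj (u (cnj \<zeta>)) = v \<zeta> * cnj (v \<zeta>)"
    "u (cnj \<zeta>) * cnj (v (cnj \<zeta>)) = v \<zeta> * cnj (u \<zeta>)" by auto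
qed

lemma X_mat_projection:
  assumes n: "n > 0" and P: "mu_partition n H F C" and U: "unit_vector_choice H u v"
  shows "X_mat n H F u v \<in> SD n" "self_adjoint (X_mat n H F u v)"
    "idempotent_mat (X_mat n H F u v)" "vec_space.rank (2 * n) (X_mat n H F u v) = n"
proof -
  note D = mu_partitionD[OF P]
  let ?M = "projection_coeff H F u v"
  have X: "X_mat n H F u v = block_fourier n ?M" by (rule X_mat_fourier[OF n D(1-3)])
  \<comment> \<open>The witnesses for \<open>SD_iff_fourier\<close> are the two entries of the first
    row; closure of \<open>H\<close> and \<open>F\<close> under conjugation supplies the second
    row.\<close>
  have "?M \<zeta> s t = (if s = t then \<lambda>\<zeta>. ?M \<zeta> 0 0 else (\<lambda>\<zeta>. ?M \<zeta> 0 1)) (if s = 0 then \<zeta> else cnj \<zeta>)"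
    if "\<zeta> \<in> roots_of_unity n" "s < 2" "t < 2" for \<zeta> s t
    using that D(4,5) unit_vector_choice_cnj[OF U _ n]
    by (auto simp: less_2_cases_iff projection_coeff_def)
  then show "X_mat n H F u v \<in> SD n"
    unfolding X SD_iff_fourier[OF n] by (intro exI block_fourier_cong)
  show "self_adjoint (X_mat n H F u v)"
    unfolding X self_adjoint_def block_fourier_adjoint[OF n]
    by (rule block_fourier_cong) (auto simp: projection_coeff_def)
  have "(\<Sum>t<2. ?M \<zeta> s t * ?M \<zeta> t r) = ?M \<zeta> s r" if "s < 2" "r < 2" for \<zeta> s r
  proof (cases "\<zeta> \<in> H")
    case True
    \<comment> \<open>The product of the outer product of \<open>?w\<close> with itself is the outer
      product scaled by the squared norm, which is 1.\<close>
    let ?w = "\<lambda>s::nat. if s = 0 then u \<zeta> else v \<zeta>"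
    have "(\<Sum>t<2. ?M \<zeta> s t * ?M \<zeta> t r) =
        ?w s * cnj (?w r) * (u \<zeta> * cnj (u \<zeta>) + v \<zeta> * cnj (v \<zeta>))"
      using True by (simp add: projection_coeff_def numeral_2_eq_2 algebra_simps)
    then show ?thesis using True unit_vector_choice_norm[OF U True] by (simp add: projection_coeff_def)
  qed (use that in \<open>auto simp: projection_coeff_def less_2_cases_iff numeral_2_eq_2\<close>)
  then show idem: "idempotent_mat (X_mat n H F u v)"
    unfolding X idempotent_mat_def block_fourier_mult[OF n] by (intro block_fourier_cong)
  have fin: "finite (roots_of_unity n)" by (rule finite_roots_of_unity[OF n])
  have "of_nat (vec_space.rank (2 * n) (X_mat n H F u v)) =
      (\<Sum>\<zeta>\<in>roots_of_unity n. ?M \<zeta> 0 0 + ?M \<zeta> 1 1)"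
    using rank_block_fourier_idempotent[OF n] idem unfolding X by simp
  also have "\<dots> = (\<Sum>\<zeta>\<in>roots_of_unity n. (if \<zeta> \<in> H then 1 else 0) + (if \<zeta> \<in> F then 2 else 0))"
    using unit_vector_choice_norm[OF U] D(3) by (intro sum.cong refl) (auto simp: projection_coeff_def)
  also have "\<dots> = of_nat (card H + 2 * card F)"
    using fin D(1,2) by (simp add: sum.distrib sum.If_cases Int_absorb1)
  \<comment> \<open>Since \<open>card F = card C\<close>, this is the total number of roots.\<close>
  also have "card H + 2 * card F = n"
    using mu_partition_card[OF n, of H F C] P by (auto simp: mu_partition_def)
  finally show "vec_space.rank (2 * n) (X_mat n H F u v) = n" by (simp only: of_nat_eq_iff)
qed

section \<open>From a projection to the partition and unit vectors\<close>

lemma hermitian_projection_2x2_cases: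
  fixes a b d :: complex
  assumes real: "cnj a = a" "cnj d = d"
    and idem: "a * a + b * cnj b = a" "a * b + b * d = b" "cnj b * b + d * d = d"
  obtains "a = 0" "b = 0" "d = 0" | "a = 1" "b = 0" "d = 1"
    | "a + d = 1" "\<exists>u v. a = u * cnj u \<and> b = u * cnj v \<and> d = v * cnj v"
proof (cases "a + d = 1")
  case True
  have "\<exists>u v. a = u * cnj u \<and> b = u * cnj v \<and> d = v * cnj v"
  proof (cases "a = 0")
    case True
    then show ?thesis using idem \<open>a + d = 1\<close> by (intro exI[of _ 0] exI[of _ 1]) auto
  next
    case False
    \<comment> \<open>The first idempotency equation reads \<open>r * r\<close> plus the squared
      modulus of \<open>b\<close> equals \<open>r\<close>, so \<open>r\<close> is nonnegative.
      Choosing \<open>u\<close> as its real square root fixes the free phase, and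
      \<open>b = u * cnj v\<close> then forces \<open>v\<close>.\<close>
    define r where "r = Re a"
    have a: "a = of_real r" using real(1) by (simp add: r_def complex_eq_iff)
    have "Re (a * a + b * cnj b) = r" using idem(1) by (simp add: r_def)
    then have "r * r + (Re b * Re b + Im b * Im b) = r" by (simp add: a)
    then have "r \<ge> 0" by (metis add_nonneg_nonneg zero_le_square)
    then have s: "of_real (sqrt r) * of_real (sqrt r) = a" "sqrt r \<noteq> 0"
      using False by (auto simp: a simp flip: of_real_mult)
    let ?s = "complex_of_real (sqrt r)"
    have "d = 1 - a" "b * cnj b = a - a * a"
      using idem(1) \<open>a + d = 1\<close> by (metis add_diff_cancel_left')+
    \<comment> \<open>The determinant vanishes, which gives \<open>v\<close> the squared modulus
      \<open>d\<close>.\<close>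
    then have "b * cnj b = a * d" by (simp add: right_diff_distrib)
    then have "(cnj b / ?s) * cnj (cnj b / ?s) = d"
      using s False by (simp add: field_simps)
    then show ?thesis using s by (intro exI[of _ ?s] exI[of _ "cnj b / ?s"]) auto
  qed
  then show thesis using True that(3) by blast
next
  case False
  \<comment> \<open>Away from trace 1 the off-diagonal equation forces \<open>b = 0\<close>. Then
    \<open>a\<close> and \<open>d\<close> are 0 or 1, and they agree because their sum is not
    1.\<close>
  have "b * (a + d - 1) = 0" using idem(2) by (simp add: algebra_simps)
  then have "b = 0" using False by simp
  then have "a * (a - 1) = 0" "d * (d - 1) = 0" using idem(1,3) by (simp_all add: algebra_simps)
  then show thesis using \<open>b = 0\<close> False that(1,2) by auto
qed

text \<open>This is the case of a real root, where both diagonal entries coincide: trace 1 gives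
  \<open>a = 1 / 2\<close>, and then \<open>b\<close> squares to \<open>1 / 4\<close>. The two
  solutions are the two signs allowed for \<open>v\<close>.\<close>

lemma real_rank_one_2x2:
  fixes a b :: complex
  assumes "a + a = 1" "cnj b = b" "a * a + b * cnj b = a"
  shows "a = 1 / 2" "b = 1 / 2 \<or> b = - (1 / 2)"
proof -
  show a: "a = 1 / 2" using assms(1) by (simp add: field_simps)
  have "(b - 1 / 2) * (b + 1 / 2) = 0" using assms(2,3) a by (simp add: field_simps)
  then show "b = 1 / 2 \<or> b = - (1 / 2)" by (auto simp: add_eq_0_iff2)
qed

lemma projection_X_mat:
  assumes n: "n > 0" and SD: "X \<in> SD n" and sa: "self_adjoint X" and idem: "idempotent_mat X"
    and rank: "vec_space.rank (2 * n) X = n"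
  obtains H F C u v where "mu_partition n H F C" "unit_vector_choice H u v" "X = X_mat n H F u v"
proof -
  obtain a b where X: "X = block_fourier n
      (\<lambda>\<zeta> s t. (if s = t then a else b) (if s = 0 then \<zeta> else cnj \<zeta>))" (is "X = block_fourier n ?M")
    using SD SD_iff_fourier[OF n] by auto
  let ?R = "roots_of_unity n"
  note inj = block_fourier_inject[OF n]
  \<comment> \<open>Injectivity of the Fourier representation turns each matrix identity for
    \<open>X\<close> into one for every 2 x 2 coefficient matrix.\<close>
  have adj: "cnj (?M \<zeta> t s) = ?M \<zeta> s t" if "\<zeta> \<in> ?R" "s < 2" "t < 2" for \<zeta> s t
    using inj[OF _ that(2,3,1)] sa unfolding X self_adjoint_def block_fourier_adjoint[OF n] by blast
  have sq: "(\<Sum>r<2. ?M \<zeta> s r * ?M \<zeta> r t) = ?M \<zeta> s t" if "\<zeta> \<in> ?R" "s < 2" "t < 2" for \<zeta> s t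
    using inj[OF _ that(2,3,1)] idem unfolding X idempotent_mat_def block_fourier_mult[OF n] by blast
  have ra: "cnj (a \<zeta>) = a \<zeta>" if "\<zeta> \<in> ?R" for \<zeta> using adj[OF that, of 0 0] by simp
  have rb: "b (cnj \<zeta>) = cnj (b \<zeta>)" if "\<zeta> \<in> ?R" for \<zeta> using adj[OF that, of 1 0] by simp
  have sq1: "a \<zeta> * a \<zeta> + b \<zeta> * cnj (b \<zeta>) = a \<zeta>" if "\<zeta> \<in> ?R" for \<zeta>
    using sq[OF that, of 0 0] by (simp add: numeral_2_eq_2 rb that)
  have sq2: "a \<zeta> * b \<zeta> + b \<zeta> * a (cnj \<zeta>) = b \<zeta>" if "\<zeta> \<in> ?R" for \<zeta>
    using sq[OF that, of 0 1] by (simp add: numeral_2_eq_2)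
  have sq3: "cnj (b \<zeta>) * b \<zeta> + a (cnj \<zeta>) * a (cnj \<zeta>) = a (cnj \<zeta>)" if "\<zeta> \<in> ?R" for \<zeta>
    using sq[OF that, of 1 1] by (simp add: numeral_2_eq_2 rb that)
  \<comment> \<open>The trace of the coefficient matrix at \<zeta>. Its invariance under conjugation
    makes the three sets below closed under conjugation.\<close>
  define tr where "tr \<zeta> = a \<zeta> + a (cnj \<zeta>)" for \<zeta>
  have tr_cnj: "tr (cnj \<zeta>) = tr \<zeta>" for \<zeta> by (simp add: tr_def add.commute)
  define H where "H = {\<zeta> \<in> ?R. tr \<zeta> = 1}"
  define F where "F = {\<zeta> \<in> ?R. tr \<zeta> = 2}"
  define C where "C = {\<zeta> \<in> ?R. tr \<zeta> = 0}"
  have cases: "(\<zeta> \<in> C \<and> a \<zeta> = 0 \<and> b \<zeta> = 0 \<and> a (cnj \<zeta>) = 0) \<or>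
      (\<zeta> \<in> F \<and> a \<zeta> = 1 \<and> b \<zeta> = 0 \<and> a (cnj \<zeta>) = 1) \<or>
      (\<zeta> \<in> H \<and> (\<exists>p q. a \<zeta> = p * cnj p \<and> b \<zeta> = p * cnj q \<and> a (cnj \<zeta>) = q * cnj q))"
    if "\<zeta> \<in> ?R" for \<zeta>
    by (rule hermitian_projection_2x2_cases[of "a \<zeta>" "a (cnj \<zeta>)" "b \<zeta>"])
       (use that ra[of "cnj \<zeta>"] in \<open>simp_all add: ra sq1 sq2 sq3 H_def F_def C_def tr_def\<close>)
  have disj: "H \<inter> F = {}" "H \<inter> C = {}" "F \<inter> C = {}" by (auto simp: H_def F_def C_def)
  have un: "H \<union> F \<union> C = ?R" using cases by (auto simp: H_def F_def C_def)
  have HR: "H \<subseteq> ?R" and FR: "F \<subseteq> ?R" using un by auto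
  have fin: "finite ?R" by (rule finite_roots_of_unity[OF n])
  \<comment> \<open>The rank is the sum of these traces; comparing it with the number of all roots
    yields \<open>card F = card C\<close>.\<close>
  have "of_nat n = (\<Sum>\<zeta>\<in>?R. tr \<zeta>)"
    using rank_block_fourier_idempotent[OF n, of ?M] idem rank unfolding X tr_def by simp
  also have "\<dots> = (\<Sum>\<zeta>\<in>?R. (if \<zeta> \<in> H then 1 else 0) + (if \<zeta> \<in> F then 2 else 0))"
    using cases by (intro sum.cong refl) (auto simp: H_def F_def C_def)
  also have "\<dots> = of_nat (card H + 2 * card F)"
    using fin HR FR by (simp add: sum.distrib sum.If_cases Int_absorb1)
  finally have "card H + 2 * card F = n" by (simp only: of_nat_eq_iff)
  then have "card F = card C" using mu_partition_card[OF n un disj] by simp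
  then have P: "mu_partition n H F C"
    using un disj by (auto simp: mu_partition_def conj_closed_def H_def F_def C_def tr_cnj)
  have "\<forall>\<zeta>. \<exists>p q. \<zeta> \<in> H \<longrightarrow> a \<zeta> = p * cnj p \<and> b \<zeta> = p * cnj q \<and> a (cnj \<zeta>) = q * cnj q"
    using cases HR disj by blast
  then obtain p q where pq:
    "\<zeta> \<in> H \<Longrightarrow> a \<zeta> = p \<zeta> * cnj (p \<zeta>) \<and> b \<zeta> = p \<zeta> * cnj (q \<zeta>) \<and> a (cnj \<zeta>) = q \<zeta> * cnj (q \<zeta>)" for \<zeta>
    by metis
  let ?c = "complex_of_real (1 / sqrt 2)"
  have cc: "?c * ?c = 1 / 2" unfolding of_real_mult[symmetric] by simp
  \<comment> \<open>The factorizations \<open>p\<close>, \<open>q\<close> at conjugate roots are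
    chosen independently. Those in the upper half-plane are kept and swapped to obtain the lower
    half-plane, as \<open>unit_vector_choice\<close> asks. At real roots \<open>u\<close> is
    prescribed, and \<open>b\<close> determines the sign of \<open>v\<close>.\<close>
  define u where "u \<zeta> = (if Im \<zeta> > 0 then p \<zeta> else if Im \<zeta> < 0 then q (cnj \<zeta>) else ?c)" for \<zeta>
  define v where "v \<zeta> = (if Im \<zeta> > 0 then q \<zeta> else if Im \<zeta> < 0 then p (cnj \<zeta>)
                            else if b \<zeta> = 1 / 2 then ?c else - ?c)" for \<zeta>
  have real: "\<zeta>\<^sup>2 = 1 \<longleftrightarrow> Im \<zeta> = 0" if "\<zeta> \<in> ?R" for \<zeta>
    using root_of_unity_square_eq_1_iff[OF n that] by (auto simp: complex_eq_iff)
  have uv: "a \<zeta> = u \<zeta> * cnj (u \<zeta>) \<and> b \<zeta> = u \<zeta> * cnj (v \<zeta>) \<and> a (cnj \<zeta>) = v \<zeta> * cnj (v \<zeta>)"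
    if "\<zeta> \<in> H" for \<zeta>
  proof -
    have \<zeta>: "\<zeta> \<in> ?R" "cnj \<zeta> \<in> H" using that HR mu_partitionD(4)[OF P] by auto
    consider "Im \<zeta> > 0" | "Im \<zeta> < 0" | "Im \<zeta> = 0" by linarith
    then show ?thesis
    proof cases
      case 1
      then show ?thesis using pq[OF that] by (simp add: u_def v_def)
    next
      case 2
      \<comment> \<open>By this symmetry the swapped pair from the conjugate root also factors the
        coefficient matrix at \<zeta>.\<close>
      then have "b \<zeta> = cnj (b (cnj \<zeta>))" using rb[OF \<zeta>(1)] by simp
      then show ?thesis using 2 pq[OF \<zeta>(2)] by (simp add: u_def v_def)
    next
      case 3
      then have c: "cnj \<zeta> = \<zeta>" by (simp add: complex_eq_iff)
      have *: "a \<zeta> = 1 / 2" "b \<zeta> = 1 / 2 \<or> b \<zeta> = - (1 / 2)"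
        using real_rank_one_2x2[of "a \<zeta>" "b \<zeta>"] that sq1[OF \<zeta>(1)] rb[OF \<zeta>(1)]
        by (auto simp: H_def tr_def c)
      show ?thesis using 3 * cc by (auto simp: u_def v_def c)
    qed
  qed
  have U: "unit_vector_choice H u v"
    unfolding unit_vector_choice_def
  proof (intro conjI ballI impI)
    fix \<zeta> assume \<zeta>: "\<zeta> \<in> H"
    \<comment> \<open>The squared norm of the vector is the trace of its outer product, which is 1
      on \<open>H\<close>.\<close>
    have "complex_of_real ((cmod (v \<zeta>))\<^sup>2 + (cmod (u \<zeta>))\<^sup>2) = 1"
      using uv[OF \<zeta>] \<zeta> unfolding of_real_add complex_norm_square
      by (simp add: H_def tr_def add.commute)
    then show "(cmod (v \<zeta>))\<^sup>2 + (cmod (u \<zeta>))\<^sup>2 = 1" by (simp only: of_real_eq_1_iff)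
    have "\<zeta> \<in> ?R" using \<zeta> HR by blast
    note real = real[OF this]
    show "v (cnj \<zeta>) = u \<zeta>" "u (cnj \<zeta>) = v \<zeta>" if "\<zeta>\<^sup>2 \<noteq> 1"
      using that real by (auto simp: u_def v_def)
    show "u \<zeta> = ?c" "v \<zeta> = ?c \<or> v \<zeta> = - ?c" if "\<zeta>\<^sup>2 = 1"
      using that real by (auto simp: u_def v_def)
  qed
  have "?M \<zeta> s t = projection_coeff H F u v \<zeta> s t" if "\<zeta> \<in> ?R" "s < 2" "t < 2" for \<zeta> s t
    using cases[OF that(1)] that uv[of \<zeta>] disj rb[OF that(1)]
    by (auto simp: less_2_cases_iff projection_coeff_def)
  then have "X = X_mat n H F u v"
    unfolding X X_mat_fourier[OF n HR FR disj(1)] by (intro block_fourier_cong)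
  then show thesis using P U that by blast
qed

theorem theorem4p8:
  fixes n :: nat
  assumes "n > 0"
  shows "(\<forall>H F C u v. mu_partition n H F C \<and> unit_vector_choice H u v \<longrightarrow>
            X_mat n H F u v \<in> SD n \<and>
            self_adjoint (X_mat n H F u v) \<and>
            idempotent_mat (X_mat n H F u v) \<and>
            vec_space.rank (2 * n) (X_mat n H F u v) = n) \<and>
         (\<forall>X. X \<in> SD n \<and> self_adjoint X \<and> idempotent_mat X \<and> vec_space.rank (2 * n) X = n \<longrightarrow>
            (\<exists>H F C u v. mu_partition n H F C \<and> unit_vector_choice H u v \<and>
               X = X_mat n H F u v))"
  using X_mat_projection[OF assms] projection_X_mat[OF assms] by metis

end
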